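(* Let $\alpha,\beta\in\mathbb{C}$. The system $$q' = p^2 + zq + \alpha,\qquad p' = -q^2 - zp - \beta$$ describes a regular initial value problem on the space of initial conditions $\mathcal{I}$: for every $z_0\in\mathbb{C}$ and every point $P$ of $\mathcal{I}$ (formed at $z=z_0$), there is one of the coordinate charts of $\mathcal{I}$ which contains $P$ and in which the system, rewritten in the coordinates of that chart, has right-hand sides analytic in a neighbourhood of ($z_0$, coordinates of $P$).
   Context: Here $z$ is the complex independent variable, $'=d/dz$, $\alpha,\beta$ are complex constants, $\omega=\frac{-1+i\sqrt3}{2}$, and bars denote complex conjugation, so $\bar\rho=\rho^{-1}=\rho^2$ for $\rho\in\{1,\omega,\bar\omega\}$. Compactification. The phase space $\mathbb{C}^2$ of $(q,p)$ is compactified to $\mathbb{CP}^2$ with the three standard affine charts $(q,p)$, $(u_1,u_2)$, $(v_1,v_2)$ related by $[1:q:p]=[u_1:1:u_2]=[v_1:v_2:1]$, i.e. $u_1=1/q$, $u_2=p/q$, $v_1=1/p$, $v_2=q/p$. $L$ denotes the line at infinity ($u_1=0$, resp. $v_1=0$). Blow-ups. For each $z$ and each $\rho\in\{1,\omega,\bar\omega\}$ one performs three successive blow-ups (nine in total), the second and third centred at a point on the preceding exceptional curve; the space and the centres depend on $z$. (1) Blow up $(u_1,u_2)=(0,-\rho)$, with new charts $u_{1,1}=\frac{u_1}{u_2+\rho}$, $u_{1,2}=u_2+\rho$, and $u_{2,1}=u_1$, $u_{2,2}=\frac{u_2+\rho}{u_1}$. The exceptional curve is $L_1^{(\rho)}$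 ($u_{1,2}=0$, resp. $u_{2,1}=0$). (2) Blow up the point $(u_{2,1},u_{2,2})=(0,\bar\rho z)$, with new charts $\hat u_{1,1}=\frac{u_{2,1}}{u_{2,2}-\bar\rho z}$, $\hat u_{1,2}=u_{2,2}-\bar\rho z$, and $\hat u_{2,1}=u_{2,1}$, $\hat u_{2,2}=\frac{u_{2,2}-\bar\rho z}{u_{2,1}}$. The exceptional curve is $L_2^{(\rho)}$ ($\hat u_{1,2}=0$, resp. $\hat u_{2,1}=0$). (3) Blow up the point $(\hat u_{2,1},\hat u_{2,2})=(0,\bar\rho\alpha-\rho\beta-1)$, with new charts $\tilde u_{1,1}=\frac{\hat u_{2,1}}{\hat u_{2,2}+1-\bar\rho\alpha+\rho\beta}$, $\tilde u_{1,2}=\hat u_{2,2}+1-\bar\rho\alpha+\rho\beta$, and $\tilde u_{2,1}=\hat u_{2,1}$, $\tilde u_{2,2}=\frac{\hat u_{2,2}+1-\bar\rho\alpha+\rho\beta}{\hat u_{2,1}}$. The exceptional curve is $L_3^{(\rho)}$ ($\tilde u_{1,2}=0$, resp. $\tilde u_{2,1}=0$). In terms of the original variables, $\tilde u_{2,1}=\frac1q$ and $\tilde u_{2,2}=q\,r$ with $r=1-\bar\rho\alpha+\rho\beta-\bar\rho zq+\rho q^2+qp$; inversely, $q=\frac{1}{\tilde u_{2,1}}$ and $p=-\frac{\rho}{\tilde u_{2,1}}+\bar\rho z-(1-\bar\rho\alpha+\rho\beta)\tilde u_{2,1}+\tilde u_{2,1}^2\tilde u_{2,2}$. Space of initial conditions.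 Let $\mathcal{S}$ be the compact space obtained from $\mathbb{CP}^2$ by these three blow-ups at each of the three base points $(u_1,u_2)=(0,-\rho)$, $\rho\in\{1,\omega,\bar\omega\}$, covered by the coordinate charts $(q,p)$, $(u_1,u_2)$, $(v_1,v_2)$ and, for each $\rho\in\{1,\omega,\bar\omega\}$, $(u_{1,1},u_{1,2})$, $(u_{2,1},u_{2,2})$, $(\hat u_{1,1},\hat u_{1,2})$, $(\hat u_{2,1},\hat u_{2,2})$, $(\tilde u_{1,1},\tilde u_{1,2})$, $(\tilde u_{2,1},\tilde u_{2,2})$. Then $$\mathcal{I}=\mathcal{S}\setminus\left(L\cup L_1^{(1)}\cup L_1^{(\omega)}\cup L_1^{(\bar\omega)}\cup L_2^{(1)}\cup L_2^{(\omega)}\cup L_2^{(\bar\omega)}\right),$$ where $L$, $L_1^{(\rho)}$, $L_2^{(\rho)}$ denote the corresponding curves in $\mathcal{S}$ (their proper transforms under the later blow-ups). *)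

theory Defs
  imports "HOL-Analysis.Analysis"
begin

section \<open>Points\<close>

text \<open>Homogeneous coordinates, as orbits of nonzero scalings.\<close>

definition hom2 :: "complex \<Rightarrow> complex \<Rightarrow> (complex \<times> complex) set" where
  "hom2 a b = {(k * a, k * b) | k. k \<noteq> 0}"

definition hom3 :: "complex \<Rightarrow> complex \<Rightarrow> complex \<Rightarrow> (complex \<times> complex \<times> complex) set" where
  "hom3 a b c = {(k * a, k * b, k * c) | k. k \<noteq> 0}"

text \<open>A point of an iterated blow-up of the projective plane is either a point of the plane or
  a point infinitely near to a blown-up point \<open>c\<close>, that is, a point \<open>Near c d\<close> of the exceptional
  curve over \<open>c\<close>, with \<open>d\<close> in the projective line of directions at \<open>c\<close>.\<close>

datatype point =
    Proj "(complex \<times> complex \<times> complex) set"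
  | Near point "(complex \<times> complex) set"


section \<open>Surfaces given by coordinate charts\<close>

datatype chart =
    QP | U | V
  | U1 complex | U2 complex
  | Uhat1 complex | Uhat2 complex
  | Utilde1 complex | Utilde2 complex

text \<open>Each chart is given by the set of its coordinate pairs and by the map sending a coordinate
  pair to the point with these coordinates. Chart names that are not in use have empty domain.\<close>

type_synonym surface = "chart \<Rightarrow> (complex \<times> complex) set \<times> (complex \<times> complex \<Rightarrow> point)"

abbreviation chart_dom :: "surface \<Rightarrow> chart \<Rightarrow> (complex \<times> complex) set" where
  "chart_dom S n \<equiv> fst (S n)"

abbreviation chart_point :: "surface \<Rightarrow> chart \<Rightarrow> complex \<times> complex \<Rightarrow> point" where
  "chart_point S n \<equiv> snd (S n)"

definition points :: "surface \<Rightarrow> point set" where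
  "points S = (\<Union>n. chart_point S n ` chart_dom S n)"

definition remove :: "point set \<Rightarrow> surface \<Rightarrow> surface" where
  "remove C S = (\<lambda>n. ({w \<in> chart_dom S n. chart_point S n w \<notin> C}, chart_point S n))"

text \<open>The topology for which a set is open iff its trace in every chart is.\<close>

definition surface_topology :: "surface \<Rightarrow> point topology" where
  "surface_topology S = topology (\<lambda>T. T \<subseteq> points S \<and>
     (\<forall>n. openin (top_of_set (chart_dom S n)) {w \<in> chart_dom S n. chart_point S n w \<in> T}))"

lemma openin_surface_topology:
  "openin (surface_topology S) T \<longleftrightarrow> T \<subseteq> points S \<and>
     (\<forall>n. openin (top_of_set (chart_dom S n)) {w \<in> chart_dom S n. chart_point S n w \<in> T})"
proof -
  let ?O = "\<lambda>T. T \<subseteq> points S \<and>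
     (\<forall>n. openin (top_of_set (chart_dom S n)) {w \<in> chart_dom S n. chart_point S n w \<in> T})"
  have "istopology ?O"
    unfolding istopology_def
  proof (intro conjI allI impI)
    fix A B n assume A: "?O A" and B: "?O B"
    have "{w \<in> chart_dom S n. chart_point S n w \<in> A \<inter> B} =
        {w \<in> chart_dom S n. chart_point S n w \<in> A} \<inter> {w \<in> chart_dom S n. chart_point S n w \<in> B}"
      by auto
    then show "openin (top_of_set (chart_dom S n)) {w \<in> chart_dom S n. chart_point S n w \<in> A \<inter> B}"
      using openin_Int[OF A[THEN conjunct2, THEN spec] B[THEN conjunct2, THEN spec]] by (simp only:)
    show "A \<inter> B \<subseteq> points S" using A by blast
  next
    fix K n assume K: "\<forall>T\<in>K. ?O T"
    have "{w \<in> chart_dom S n. chart_point S n w \<in> \<Union>K} =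
        \<Union>((\<lambda>T. {w \<in> chart_dom S n. chart_point S n w \<in> T}) ` K)"
      by blast
    moreover have "openin (top_of_set (chart_dom S n))
        (\<Union>((\<lambda>T. {w \<in> chart_dom S n. chart_point S n w \<in> T}) ` K))"
      by (rule openin_Union) (use K in blast)
    ultimately show "openin (top_of_set (chart_dom S n))
        {w \<in> chart_dom S n. chart_point S n w \<in> \<Union>K}"
      by (simp only:)
    show "\<Union>K \<subseteq> points S" using K by blast
  qed
  from topology_inverse'[OF this] show ?thesis
    unfolding surface_topology_def by (rule fun_cong)
qed


section \<open>Blow-ups\<close>

text \<open>\<open>blow_up n (x0, y0) n1 n2 S\<close> is the blow-up of \<open>S\<close> at the point with coordinates
  \<open>(x0, y0)\<close> in chart \<open>n\<close>. With \<open>(x, y)\<close> the coordinates of chart \<open>n\<close>, the new chart \<open>n1\<close> has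
  coordinates \<open>((x - x0) / (y - y0), y - y0)\<close>, and \<open>n2\<close> has \<open>(x - x0, (y - y0) / (x - x0))\<close>.\<close>

definition blow_up ::
  "chart \<Rightarrow> complex \<times> complex \<Rightarrow> chart \<Rightarrow> chart \<Rightarrow> surface \<Rightarrow> surface" where
  "blow_up n c n1 n2 S = (let P = chart_point S n c in
     (remove {P} S)
       (n1 := ({(a, b). (fst c + a * b, snd c + b) \<in> chart_dom S n},
               \<lambda>(a, b). if b = 0 then Near P (hom2 a 1)
                        else chart_point S n (fst c + a * b, snd c + b)),
        n2 := ({(a, b). (fst c + a, snd c + a * b) \<in> chart_dom S n},
               \<lambda>(a, b). if a = 0 then Near P (hom2 1 b)
                        else chart_point S n (fst c + a, snd c + a * b))))"

definition exceptional_curve :: "point \<Rightarrow> point set" where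
  "exceptional_curve P = {Near P (hom2 a b) | a b. (a, b) \<noteq> (0, 0)}"

text \<open>Points that are not blown up keep their name, so the proper transform in \<open>S\<close> of a curve \<open>C\<close>
  of an earlier surface is the closure of what is left of \<open>C\<close>.\<close>

definition proper_transform :: "surface \<Rightarrow> point set \<Rightarrow> point set" where
  "proper_transform S C = surface_topology S closure_of (C \<inter> points S)"


section \<open>The space of initial conditions\<close>

definition CP2 :: surface where
  "CP2 = (\<lambda>_. ({}, undefined))
     (QP := (UNIV, \<lambda>(q, p). Proj (hom3 1 q p)),
      U := (UNIV, \<lambda>(u1, u2). Proj (hom3 u1 1 u2)),
      V := (UNIV, \<lambda>(v1, v2). Proj (hom3 v1 v2 1)))"

definition omega :: complex where
  "omega = (-1 + \<i> * of_real (sqrt 3)) / 2"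

definition blow_up_tower :: "complex \<Rightarrow> complex \<Rightarrow> complex \<Rightarrow> complex \<Rightarrow> surface \<Rightarrow> surface" where
  "blow_up_tower \<alpha> \<beta> z \<rho> S =
     blow_up (Uhat2 \<rho>) (0, cnj \<rho> * \<alpha> - \<rho> * \<beta> - 1) (Utilde1 \<rho>) (Utilde2 \<rho>)
      (blow_up (U2 \<rho>) (0, cnj \<rho> * z) (Uhat1 \<rho>) (Uhat2 \<rho>)
        (blow_up U (0, - \<rho>) (U1 \<rho>) (U2 \<rho>) S))"

definition compact_space :: "complex \<Rightarrow> complex \<Rightarrow> complex \<Rightarrow> surface" where
  "compact_space \<alpha> \<beta> z =
     blow_up_tower \<alpha> \<beta> z (cnj omega) (blow_up_tower \<alpha> \<beta> z omega (blow_up_tower \<alpha> \<beta> z 1 CP2))"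

text \<open>The curves \<open>L\<close>, \<open>L1 \<rho>\<close>, \<open>L2 \<rho>\<close> at the stage where they first appear. The centre of the
  second blow-up is the point of \<open>L1 \<rho>\<close> in direction \<open>[u1 : u2 + \<rho>] = [1 : cnj \<rho> * z]\<close>.\<close>

definition line_at_infinity :: "point set" where
  "line_at_infinity = chart_point CP2 U ` {(u1, u2). u1 = 0} \<union> chart_point CP2 V ` {(v1, v2). v1 = 0}"

definition centre1 :: "complex \<Rightarrow> point" where
  "centre1 \<rho> = Proj (hom3 0 1 (- \<rho>))"

definition centre2 :: "complex \<Rightarrow> complex \<Rightarrow> point" where
  "centre2 z \<rho> = Near (centre1 \<rho>) (hom2 1 (cnj \<rho> * z))"

definition removed_curves :: "complex \<Rightarrow> complex \<Rightarrow> complex \<Rightarrow> point set" where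
  "removed_curves \<alpha> \<beta> z =
     proper_transform (compact_space \<alpha> \<beta> z) line_at_infinity \<union>
     (\<Union>\<rho>\<in>{1, omega, cnj omega}.
        proper_transform (compact_space \<alpha> \<beta> z) (exceptional_curve (centre1 \<rho>)) \<union>
        proper_transform (compact_space \<alpha> \<beta> z) (exceptional_curve (centre2 z \<rho>)))"

definition initial_space :: "complex \<Rightarrow> complex \<Rightarrow> complex \<Rightarrow> surface" where
  "initial_space \<alpha> \<beta> z = remove (removed_curves \<alpha> \<beta> z) (compact_space \<alpha> \<beta> z)"


section \<open>The system and its coordinate changes\<close>

definition system_at ::
  "complex \<Rightarrow> complex \<Rightarrow> (complex \<Rightarrow> complex) \<Rightarrow> (complex \<Rightarrow> complex) \<Rightarrow> complex \<Rightarrow> bool" where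
  "system_at \<alpha> \<beta> q p z \<longleftrightarrow>
     (q has_field_derivative ((p z)^2 + z * q z + \<alpha>)) (at z) \<and>
     (p has_field_derivative (- ((q z)^2) - z * p z - \<beta>)) (at z)"

text \<open>On \<open>W\<close>, the system rewritten in the coordinates \<open>(x, y)\<close> of chart \<open>n\<close> reads
  \<open>x' = F (z, x, y)\<close>, \<open>y' = G (z, x, y)\<close>: for all functions of \<open>z\<close> related by the (\<open>z\<close>-dependent)
  change of coordinates, the two pairs of equations are equivalent. At points of \<open>W\<close> outside the
  chart \<open>QP\<close> nothing is said about \<open>F\<close> and \<open>G\<close> here; there they are determined by continuity.\<close>

definition rewritten_system ::
  "complex \<Rightarrow> complex \<Rightarrow> chart \<Rightarrow> (complex \<times> complex \<times> complex) set \<Rightarrow>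
   (complex \<times> complex \<times> complex \<Rightarrow> complex) \<Rightarrow> (complex \<times> complex \<times> complex \<Rightarrow> complex) \<Rightarrow> bool" where
  "rewritten_system \<alpha> \<beta> n W F G \<longleftrightarrow>
     (\<forall>q p x y z. (z, x z, y z) \<in> W \<longrightarrow>
        (\<forall>\<^sub>F t in nhds z. (x t, y t) \<in> chart_dom (compact_space \<alpha> \<beta> t) n \<and>
           chart_point (compact_space \<alpha> \<beta> t) n (x t, y t) =
           chart_point (compact_space \<alpha> \<beta> t) QP (q t, p t)) \<longrightarrow>
        (system_at \<alpha> \<beta> q p z \<longleftrightarrow>
           (x has_field_derivative F (z, x z, y z)) (at z) \<and>
           (y has_field_derivative G (z, x z, y z)) (at z)))"

text \<open>Analyticity in three complex variables: local expansion in a convergent power series.\<close>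

definition analytic3_on ::
  "(complex \<times> complex \<times> complex \<Rightarrow> complex) \<Rightarrow> (complex \<times> complex \<times> complex) set \<Rightarrow> bool" where
  "analytic3_on F W \<longleftrightarrow>
     (\<forall>(a, b, c)\<in>W. \<exists>C :: nat \<times> nat \<times> nat \<Rightarrow> complex. \<exists>r>0. \<forall>h k l.
        norm h < r \<and> norm k < r \<and> norm l < r \<longrightarrow>
        ((\<lambda>(i, j, m). C (i, j, m) * h ^ i * k ^ j * l ^ m) has_sum F (a + h, b + k, c + l)) UNIV)"

end

(* In the coordinates x = 1/q, y of the last chart over each base point, the three centres are exactly
   those for which the poles at x = 0 of the transformed vector field cancel: the right-hand sides
   become polynomials in (z, x, y). Everything at infinity other than the points (0, y) of these
   charts lies on a removed curve, so the affine chart and these three charts suffice. *)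
theory Submission
  imports Defs
begin

section \<open>Polynomials are analytic\<close>

text \<open>Convergence is demanded for all increments, not only small ones: polynomials satisfy
  this, and no radius has to be tracked.\<close>

definition expandable :: "complex \<times> complex \<times> complex \<Rightarrow> (complex \<times> complex \<times> complex \<Rightarrow> complex) \<Rightarrow> bool" where
  "expandable p F \<longleftrightarrow> (\<exists>C :: nat \<times> nat \<times> nat \<Rightarrow> complex. \<forall>h k l.
     ((\<lambda>(i, j, m). C (i, j, m) * h ^ i * k ^ j * l ^ m) has_sum F (p + (h, k, l))) UNIV)"

lemma expandable_add:
  assumes "expandable p F" "expandable p G"
  shows "expandable p (\<lambda>v. F v + G v)"
proof -
  obtain C D where C: "\<And>h k l. ((\<lambda>(i, j, m). C (i, j, m) * h ^ i * k ^ j * l ^ m) has_sum F (p + (h, k, l))) UNIV"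
    and D: "\<And>h k l. ((\<lambda>(i, j, m). D (i, j, m) * h ^ i * k ^ j * l ^ m) has_sum G (p + (h, k, l))) UNIV"
    using assms unfolding expandable_def by blast
  show ?thesis
    unfolding expandable_def
    by (rule exI[of _ "\<lambda>s. C s + D s"])
      (use has_sum_add[OF C D] in \<open>simp add: case_prod_unfold algebra_simps\<close>)
qed

lemma expandable_scale:
  assumes "expandable p F"
  shows "expandable p (\<lambda>v. c * F v)"
proof -
  obtain C where C: "\<And>h k l. ((\<lambda>(i, j, m). C (i, j, m) * h ^ i * k ^ j * l ^ m) has_sum F (p + (h, k, l))) UNIV"
    using assms unfolding expandable_def by blast
  show ?thesis
    unfolding expandable_def
    by (rule exI[of _ "\<lambda>s. c * C s"])
      (use has_sum_cmult_right[OF C, of c] in \<open>simp add: case_prod_unfold mult.assoc\<close>)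
qed

lemma expandable_const: "expandable p (\<lambda>v. c)"
proof -
  define C :: "nat \<times> nat \<times> nat \<Rightarrow> complex" where "C s = (if s = (0, 0, 0) then c else 0)" for s
  have "((\<lambda>(i, j, m). C (i, j, m) * h ^ i * k ^ j * l ^ m) has_sum c) UNIV" for h k l
    by (rule has_sum_finite_neutralI[of "{(0, 0, 0)}"]) (auto simp: C_def split: if_splits)
  then show ?thesis
    unfolding expandable_def by blast
qed

text \<open>Multiplying a series by one of its variables only shifts the coefficients.\<close>

lemma has_sum_shift:
  fixes f :: "'a \<Rightarrow> complex"
  assumes "inj s" "(f has_sum S) UNIV"
    and "\<And>i. g (s i) = c * f i" "\<And>i. i \<notin> range s \<Longrightarrow> g i = 0"
  shows "(g has_sum c * S) UNIV"
proof -
  have "((\<lambda>i. g (s i)) has_sum c * S) UNIV"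
    unfolding assms(3) by (rule has_sum_cmult_right) (rule assms(2))
  then have "(g has_sum c * S) (range s)"
    using has_sum_reindex[OF assms(1), of g "c * S"] by (simp add: o_def)
  then show ?thesis
    by (rule iffD1[OF has_sum_cong_neutral, rotated -1]) (use assms(4) in auto)
qed

lemma expandable_increment:
  assumes "expandable p F"
  shows "expandable p (\<lambda>v. fst (v - p) * F v)"
    and "expandable p (\<lambda>v. fst (snd (v - p)) * F v)"
    and "expandable p (\<lambda>v. snd (snd (v - p)) * F v)"
proof -
  obtain C where C: "\<And>h k l. ((\<lambda>(i, j, m). C (i, j, m) * h ^ i * k ^ j * l ^ m) has_sum F (p + (h, k, l))) UNIV"
    using assms unfolding expandable_def by blast
  have *: "p + (h, k, l) - p = (h, k, l)" for h k l
    by simp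
  \<comment> \<open>Old coefficients move up one place in \<open>i\<close>; the 0 at index 0
    supplies the vanishing off the range of the shift that \<open>has_sum_shift\<close> asks for.
    The other two variables are treated alike.\<close>
  have "((\<lambda>(i, j, m). (case i of 0 \<Rightarrow> 0 | Suc i' \<Rightarrow> C (i', j, m)) * h ^ i * k ^ j * l ^ m)
      has_sum h * F (p + (h, k, l))) UNIV" for h k l
    by (rule has_sum_shift[OF _ C, where s = "\<lambda>(i, j, m). (Suc i, j, m)"])
      (auto simp: inj_def image_iff split: nat.split)
  then show "expandable p (\<lambda>v. fst (v - p) * F v)"
    unfolding expandable_def *
    by (intro exI[of _ "\<lambda>(i, j, m). case i of 0 \<Rightarrow> 0 | Suc i' \<Rightarrow> C (i', j, m)"]) simp
  have "((\<lambda>(i, j, m). (case j of 0 \<Rightarrow> 0 | Suc j' \<Rightarrow> C (i, j', m)) * h ^ i * k ^ j * l ^ m)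
      has_sum k * F (p + (h, k, l))) UNIV" for h k l
    by (rule has_sum_shift[OF _ C, where s = "\<lambda>(i, j, m). (i, Suc j, m)"])
      (auto simp: inj_def image_iff split: nat.split)
  then show "expandable p (\<lambda>v. fst (snd (v - p)) * F v)"
    unfolding expandable_def *
    by (intro exI[of _ "\<lambda>(i, j, m). case j of 0 \<Rightarrow> 0 | Suc j' \<Rightarrow> C (i, j', m)"]) simp
  have "((\<lambda>(i, j, m). (case m of 0 \<Rightarrow> 0 | Suc m' \<Rightarrow> C (i, j, m')) * h ^ i * k ^ j * l ^ m)
      has_sum l * F (p + (h, k, l))) UNIV" for h k l
    by (rule has_sum_shift[OF _ C, where s = "\<lambda>(i, j, m). (i, j, Suc m)"])
      (auto simp: inj_def image_iff split: nat.split)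
  then show "expandable p (\<lambda>v. snd (snd (v - p)) * F v)"
    unfolding expandable_def *
    by (intro exI[of _ "\<lambda>(i, j, m). case m of 0 \<Rightarrow> 0 | Suc m' \<Rightarrow> C (i, j, m')"]) simp
qed

text \<open>Stated as multipliers of expandable functions, polynomials are closed under products for
  trivial reasons, and no Cauchy product of triple series is needed.\<close>

definition multiplier :: "(complex \<times> complex \<times> complex \<Rightarrow> complex) \<Rightarrow> bool" where
  "multiplier F \<longleftrightarrow> (\<forall>p G. expandable p G \<longrightarrow> expandable p (\<lambda>v. F v * G v))"

lemma multiplier_const: "multiplier (\<lambda>v. c)"
  by (simp add: multiplier_def expandable_scale)

lemma multiplier_add: "multiplier F \<Longrightarrow> multiplier G \<Longrightarrow> multiplier (\<lambda>v. F v + G v)"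
  by (simp add: multiplier_def distrib_right expandable_add)

lemma multiplier_mult: "multiplier F \<Longrightarrow> multiplier G \<Longrightarrow> multiplier (\<lambda>v. F v * G v)"
  by (simp add: multiplier_def mult.assoc)

lemma multiplier_minus: "multiplier F \<Longrightarrow> multiplier (\<lambda>v. - F v)"
  using multiplier_mult[OF multiplier_const[of "-1"], of F] by simp

lemma multiplier_diff: "multiplier F \<Longrightarrow> multiplier G \<Longrightarrow> multiplier (\<lambda>v. F v - G v)"
  using multiplier_add[OF _ multiplier_minus, of F G] by simp

lemma multiplier_power: "multiplier F \<Longrightarrow> multiplier (\<lambda>v. F v ^ n)"
  by (induction n) (simp_all add: multiplier_const multiplier_mult)

text \<open>A coordinate is its value at \<open>p\<close>, a constant, plus the increment from
  \<open>p\<close>: scaling handles the first summand, a coefficient shift the second.\<close>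

lemma multiplier_coordinates:
  "multiplier fst" "multiplier (\<lambda>v. fst (snd v))" "multiplier (\<lambda>v. snd (snd v))"
  unfolding multiplier_def
  using expandable_add[OF expandable_scale expandable_increment(1)]
    expandable_add[OF expandable_scale expandable_increment(2)]
    expandable_add[OF expandable_scale expandable_increment(3)]
proof (safe, goal_cases)
  case (1 a b c G)
  from 1(1)[OF 1(4) 1(4), of a] show ?case by (simp add: algebra_simps)
next
  case (2 a b c G)
  from 2(2)[OF 2(4) 2(4), of b] show ?case by (simp add: algebra_simps)
next
  case (3 a b c G)
  from 3(3)[OF 3(4) 3(4), of c] show ?case by (simp add: algebra_simps)
qed

lemmas multiplier_intros =
  multiplier_const multiplier_add multiplier_mult multiplier_minus multiplier_diff
  multiplier_power multiplier_coordinates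

text \<open>A multiplier is itself expandable, since it multiplies the constant 1. The series
  converges everywhere, so any positive radius will do.\<close>

lemma multiplier_analytic3_on:
  assumes "multiplier F"
  shows "analytic3_on F W"
proof -
  have F: "expandable p F" for p
    using assms[unfolded multiplier_def, rule_format, OF expandable_const[of p 1]] by simp
  show ?thesis
    unfolding analytic3_on_def
  proof (intro ballI, clarify)
    fix a b c
    obtain C where "\<And>h k l. ((\<lambda>(i, j, m). C (i, j, m) * h ^ i * k ^ j * l ^ m) has_sum
        F ((a, b, c) + (h, k, l))) UNIV"
      using F[of "(a, b, c)"] unfolding expandable_def by blast
    then show "\<exists>C :: nat \<times> nat \<times> nat \<Rightarrow> complex. \<exists>r>0. \<forall>h k l.
        norm h < r \<and> norm k < r \<and> norm l < r \<longrightarrow>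
        ((\<lambda>(i, j, m). C (i, j, m) * h ^ i * k ^ j * l ^ m) has_sum F (a + h, b + k, c + l)) UNIV"
      unfolding add_Pair by (intro exI[of _ C] exI[of _ "1::real"]) simp
  qed
qed


section \<open>Homogeneous coordinates\<close>

text \<open>An orbit with nonzero first coordinate has exactly one representative starting with 1.
  This recovers \<open>q\<close> and \<open>p\<close> from a point and keeps affine points apart
  from those at infinity.\<close>

lemma hom3_1_eq_iff: "hom3 1 q p = hom3 a b c \<longleftrightarrow> a \<noteq> 0 \<and> q = b / a \<and> p = c / a"
proof
  assume "hom3 1 q p = hom3 a b c"
  moreover have "(1, q, p) \<in> hom3 1 q p"
    unfolding hom3_def by (auto intro!: exI[of _ 1])
  ultimately obtain k where "1 = k * a" "q = k * b" "p = k * c"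
    unfolding hom3_def by auto
  then show "a \<noteq> 0 \<and> q = b / a \<and> p = c / a"
    by (metis divide_self_if mult.commute mult_zero_right nonzero_mult_div_cancel_right one_neq_zero times_divide_eq_right)
next
  assume *: "a \<noteq> 0 \<and> q = b / a \<and> p = c / a"
  show "hom3 1 q p = hom3 a b c"
    unfolding hom3_def
  proof (safe, goal_cases)
    case (1 _ _ _ k)
    with * show ?case by (intro exI[of _ "k / a"]) auto
  next
    case (2 _ _ _ k)
    with * show ?case by (intro exI[of _ "k * a"]) auto
  qed
qed

lemma hom3_0_1_eq_iff: "hom3 0 1 a = hom3 0 1 b \<longleftrightarrow> a = b"
proof
  assume "hom3 0 1 a = hom3 0 1 b"
  moreover have "(0, 1, a) \<in> hom3 0 1 a"
    unfolding hom3_def by (auto intro!: exI[of _ 1])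
  ultimately show "a = b"
    unfolding hom3_def by auto
qed simp

lemma hom2_normalize:
  "a \<noteq> 0 \<Longrightarrow> hom2 a b = hom2 1 (b / a)"
  "b \<noteq> 0 \<Longrightarrow> hom2 0 b = hom2 0 1"
proof -
  assume a: "a \<noteq> 0"
  show "hom2 a b = hom2 1 (b / a)"
    unfolding hom2_def
  proof (safe, goal_cases)
    case (1 _ _ k)
    with a show ?case by (intro exI[of _ "k * a"]) auto
  next
    case (2 _ _ k)
    with a show ?case by (intro exI[of _ "k / a"]) auto
  qed
next
  assume b: "b \<noteq> 0"
  show "hom2 0 b = hom2 0 1"
    unfolding hom2_def
  proof (safe, goal_cases)
    case (1 _ _ k)
    with b show ?case by (intro exI[of _ "k * b"]) auto
  next
    case (2 _ _ k)
    with b show ?case by (intro exI[of _ "k / b"]) auto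
  qed
qed


section \<open>The surface\<close>

lemma topspace_surface_topology: "topspace (surface_topology S) = points S"
proof -
  have "{w \<in> chart_dom S n. chart_point S n w \<in> points S} = chart_dom S n" for n
    unfolding points_def by blast
  then have "openin (surface_topology S) (points S)"
    by (simp add: openin_surface_topology)
  then show ?thesis
    unfolding topspace_def by (auto simp: openin_surface_topology)
qed

lemma proper_transform_superset: "C \<inter> points S \<subseteq> proper_transform S C"
  unfolding proper_transform_def
  by (rule closure_of_subset) (simp add: topspace_surface_topology)

lemma points_blow_up:
  "points (blow_up n c n1 n2 S) \<subseteq> points S \<union> exceptional_curve (chart_point S n c)"
proof
  fix P assume "P \<in> points (blow_up n c n1 n2 S)"
  then obtain m a b where ab: "(a, b) \<in> chart_dom (blow_up n c n1 n2 S) m"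
      "P = chart_point (blow_up n c n1 n2 S) m (a, b)"
    unfolding points_def by auto
  have ex: "Near Q (hom2 a 1) \<in> exceptional_curve Q" "Near Q (hom2 1 b) \<in> exceptional_curve Q" for Q a b
    unfolding exceptional_curve_def by force+
  have pts: "chart_point S m w \<in> points S" if "w \<in> chart_dom S m" for m w
    using that unfolding points_def by blast
  show "P \<in> points S \<union> exceptional_curve (chart_point S n c)"
    using ab
    by (auto simp: blow_up_def Let_def remove_def ex intro: pts split: if_splits)
qed

definition centre3 :: "complex \<Rightarrow> complex \<Rightarrow> complex \<Rightarrow> complex \<Rightarrow> point" where
  "centre3 \<alpha> \<beta> z \<rho> = Near (centre2 z \<rho>) (hom2 1 (cnj \<rho> * \<alpha> - \<rho> * \<beta> - 1))"

definition U_point :: "complex \<times> complex \<Rightarrow> point" where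
  "U_point = (\<lambda>(u1, u2). Proj (hom3 u1 1 u2))"

lemma U_point_centre: "U_point (0, - \<rho>) = centre1 \<rho>"
  by (simp add: U_point_def centre1_def)

lemma U_point_eq_centre1_iff: "U_point (0, - \<rho>) = centre1 \<rho>' \<longleftrightarrow> \<rho> = \<rho>'"
  by (simp add: U_point_def centre1_def hom3_0_1_eq_iff)

definition tower_charts :: "complex \<Rightarrow> chart set" where
  "tower_charts \<rho> = {U1 \<rho>, U2 \<rho>, Uhat1 \<rho>, Uhat2 \<rho>, Utilde1 \<rho>, Utilde2 \<rho>}"

text \<open>Each blow-up only deletes its centre from the charts it does not create. The assumption
  on \<open>U\<close> identifies the first centre as \<open>centre1 \<rho>\<close>. Hence the three
  towers can be studied independently.\<close>

lemma tower_other_chart: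
  assumes "n \<notin> tower_charts \<rho>" "chart_point S U = U_point"
  shows "chart_point (blow_up_tower \<alpha> \<beta> z \<rho> S) n = chart_point S n"
    and "chart_dom (blow_up_tower \<alpha> \<beta> z \<rho> S) n =
      {w \<in> chart_dom S n. chart_point S n w \<notin> {centre1 \<rho>, centre2 z \<rho>, centre3 \<alpha> \<beta> z \<rho>}}"
  using assms
  by (auto simp: tower_charts_def blow_up_tower_def blow_up_def Let_def remove_def U_point_centre
      centre2_def centre3_def)

text \<open>In \<open>Utilde2 \<rho>\<close>, composing the three inverse substitutions gives the
  nested Horner form. In \<open>Utilde1 \<rho>\<close>, a pair \<open>(0, y)\<close> with
  \<open>y\<close> nonzero lies on the second exceptional curve, in a direction offset by
  \<open>y\<close> from the third centre.\<close>

lemma tower_new_chart: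
  fixes \<alpha> \<beta> z \<rho> S
  defines "S' \<equiv> blow_up_tower \<alpha> \<beta> z \<rho> S"
  assumes "(0, - \<rho>) \<in> chart_dom S U" "chart_point S U = U_point"
  shows "(0, y) \<in> chart_dom S' (Utilde1 \<rho>)" "(0, y) \<in> chart_dom S' (Utilde2 \<rho>)"
    and "chart_point S' (Utilde1 \<rho>) (0, y) =
      (if y = 0 then Near (centre3 \<alpha> \<beta> z \<rho>) (hom2 0 1)
       else Near (centre2 z \<rho>) (hom2 1 (cnj \<rho> * \<alpha> - \<rho> * \<beta> - 1 + y)))"
    and "chart_point S' (Utilde2 \<rho>) (x, y) =
      (if x = 0 then Near (centre3 \<alpha> \<beta> z \<rho>) (hom2 1 y)
       else U_point (x, - \<rho> + x * (cnj \<rho> * z + x * (cnj \<rho> * \<alpha> - \<rho> * \<beta> - 1 + x * y))))"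
  using assms(2,3)
  by (auto simp: S'_def blow_up_tower_def blow_up_def Let_def remove_def U_point_centre
      centre2_def centre3_def)

lemma points_tower:
  assumes "chart_point S U = U_point"
  shows "points (blow_up_tower \<alpha> \<beta> z \<rho> S) \<subseteq> points S \<union> exceptional_curve (centre1 \<rho>)
    \<union> exceptional_curve (centre2 z \<rho>) \<union> exceptional_curve (centre3 \<alpha> \<beta> z \<rho>)"
proof -
  let ?S1 = "blow_up U (0, - \<rho>) (U1 \<rho>) (U2 \<rho>) S"
  let ?S2 = "blow_up (U2 \<rho>) (0, cnj \<rho> * z) (Uhat1 \<rho>) (Uhat2 \<rho>) ?S1"
  have c: "chart_point S U (0, - \<rho>) = centre1 \<rho>"
    "chart_point ?S1 (U2 \<rho>) (0, cnj \<rho> * z) = centre2 z \<rho>"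
    "chart_point ?S2 (Uhat2 \<rho>) (0, cnj \<rho> * \<alpha> - \<rho> * \<beta> - 1) = centre3 \<alpha> \<beta> z \<rho>"
    using assms by (simp_all add: blow_up_def Let_def U_point_centre centre2_def centre3_def)
  show ?thesis
    unfolding blow_up_tower_def
    using points_blow_up[of U "(0, - \<rho>)" "U1 \<rho>" "U2 \<rho>" S]
      points_blow_up[of "U2 \<rho>" "(0, cnj \<rho> * z)" "Uhat1 \<rho>" "Uhat2 \<rho>" ?S1]
      points_blow_up[of "Uhat2 \<rho>" "(0, cnj \<rho> * \<alpha> - \<rho> * \<beta> - 1)" "Utilde1 \<rho>" "Utilde2 \<rho>" ?S2]
    unfolding c by blast
qed

section \<open>The cube roots of unity\<close>

lemma omega_cnj: "cnj omega = omega\<^sup>2"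
  and omega_cube: "omega ^ 3 = 1"
  and omega_distinct: "omega \<noteq> 1" "cnj omega \<noteq> 1" "cnj omega \<noteq> omega"
proof -
  have s: "(complex_of_real (sqrt 3))\<^sup>2 = 3"
    by (metis of_real_numeral of_real_power real_sqrt_pow2 zero_le_numeral)
  show c: "cnj omega = omega\<^sup>2"
    using s by (simp add: omega_def power2_eq_square field_simps)
  show "omega ^ 3 = 1"
    using s unfolding omega_def power3_eq_cube power2_eq_square
    by (simp add: field_simps)
  \<comment> \<open>A nonzero imaginary part separates \<open>omega\<close> and its conjugate from 1
    and from each other.\<close>
  have "Im omega \<noteq> 0"
    by (simp add: omega_def)
  then show "omega \<noteq> 1" "cnj omega \<noteq> 1" "cnj omega \<noteq> omega"
    by (auto simp: complex_eq_iff)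
qed

abbreviation cube_roots :: "complex set" where
  "cube_roots \<equiv> {1, omega, cnj omega}"

lemma cube_roots:
  assumes "\<rho> \<in> cube_roots"
  shows "\<rho> ^ 3 = 1" "cnj \<rho> = \<rho>\<^sup>2"
proof -
  \<comment> \<open>These powers serve the root \<open>cnj omega = omega\<^sup>2\<close>, whose cube
    is \<open>omega ^ 6\<close> and whose square is \<open>omega ^ 4\<close>.\<close>
  have "omega * omega ^ 3 = omega ^ 4" "(omega ^ 3)\<^sup>2 = omega ^ 6"
    by (simp_all flip: power_mult power_Suc)
  then show "\<rho> ^ 3 = 1" "cnj \<rho> = \<rho>\<^sup>2"
    using assms omega_cube by (auto simp: omega_cnj simp flip: power_mult)
qed

section \<open>Charts of the compact space\<close>

lemma chart_point_CP2:
  "chart_point CP2 U = U_point" "chart_point CP2 QP = (\<lambda>(q, p). Proj (hom3 1 q p))"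
  "chart_dom CP2 U = UNIV" "chart_dom CP2 QP = UNIV"
  by (simp_all add: CP2_def U_point_def)

text \<open>The affine chart loses no point: the first centres lie on the line at infinity, and all
  later ones are infinitely near points.\<close>

lemma compact_QP:
  "chart_point (compact_space \<alpha> \<beta> z) QP = (\<lambda>(q, p). Proj (hom3 1 q p))"
  "chart_dom (compact_space \<alpha> \<beta> z) QP = UNIV"
  by (simp_all add: compact_space_def tower_other_chart tower_charts_def chart_point_CP2
      centre1_def centre2_def centre3_def hom3_1_eq_iff case_prod_unfold)

text \<open>The nesting depth of \<open>Near\<close> settles all but the last claim. There the
  depths agree, and the distinct base points make the difference.\<close>

lemma near_neq_centre:
  "Near (centre3 \<alpha> \<beta> z \<rho>) d \<noteq> centre1 \<rho>'" "Near (centre2 z \<rho>) d \<noteq> centre1 \<rho>'"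
  "Near (centre2 z \<rho>) d \<noteq> centre2 z \<rho>'" "Near (centre3 \<alpha> \<beta> z \<rho>) d \<noteq> centre2 z \<rho>'"
  "Near (centre3 \<alpha> \<beta> z \<rho>) d \<noteq> centre3 \<alpha> \<beta> z \<rho>'"
  "\<rho> \<noteq> \<rho>' \<Longrightarrow> Near (centre2 z \<rho>) d \<noteq> centre3 \<alpha> \<beta> z \<rho>'"
  by (simp_all add: centre1_def centre2_def centre3_def hom3_0_1_eq_iff)

lemma U_point_neq_centre: "U_point w \<noteq> centre2 z \<rho>" "U_point w \<noteq> centre3 \<alpha> \<beta> z \<rho>"
  by (simp_all add: U_point_def centre2_def centre3_def case_prod_unfold)

text \<open>Only the tower over \<open>\<rho>\<close> matters: the towers over the other two roots
  delete neither its base point beforehand nor the points \<open>(0, y)\<close> of its last charts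
  afterwards.\<close>

lemma compact_tower:
  fixes \<alpha> \<beta> z \<rho>
  defines "S' \<equiv> compact_space \<alpha> \<beta> z"
  assumes "\<rho> \<in> cube_roots"
  shows "(0, y) \<in> chart_dom S' (Utilde1 \<rho>)" "(0, y) \<in> chart_dom S' (Utilde2 \<rho>)"
    and "chart_point S' (Utilde1 \<rho>) (0, y) =
      (if y = 0 then Near (centre3 \<alpha> \<beta> z \<rho>) (hom2 0 1)
       else Near (centre2 z \<rho>) (hom2 1 (cnj \<rho> * \<alpha> - \<rho> * \<beta> - 1 + y)))"
    and "chart_point S' (Utilde2 \<rho>) (x, y) =
      (if x = 0 then Near (centre3 \<alpha> \<beta> z \<rho>) (hom2 1 y)
       else U_point (x, - \<rho> + x * (cnj \<rho> * z + x * (cnj \<rho> * \<alpha> - \<rho> * \<beta> - 1 + x * y))))"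
  using assms(2)
  by (auto simp: S'_def compact_space_def tower_other_chart tower_new_chart tower_charts_def
      chart_point_CP2 U_point_eq_centre1_iff near_neq_centre U_point_neq_centre
      omega_distinct omega_distinct[symmetric] simp del: complex_cnj_cancel_iff)

section \<open>Points that survive the removal of the curves\<close>

lemma points_CP2: "points CP2 \<subseteq> range (\<lambda>(q, p). Proj (hom3 1 q p)) \<union> line_at_infinity"
proof
  fix P assume "P \<in> points CP2"
  then obtain n a b where n: "(a, b) \<in> chart_dom CP2 n" "P = chart_point CP2 n (a, b)"
    unfolding points_def by auto
  show "P \<in> range (\<lambda>(q, p). Proj (hom3 1 q p)) \<union> line_at_infinity"
  proof (cases "n = QP \<or> a = 0")
    case True
    with n show ?thesis
      by (fastforce simp: CP2_def line_at_infinity_def split: if_splits)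
  next
    case False
    then have "hom3 a b' c' = hom3 1 (b' / a) (c' / a)" for b' c'
      by (simp add: eq_commute[of "hom3 a _ _"] hom3_1_eq_iff)
    with n False show ?thesis
      by (auto simp: CP2_def split: if_splits)
  qed
qed

lemma points_compact_space:
  "points (compact_space \<alpha> \<beta> z) \<subseteq> range (\<lambda>(q, p). Proj (hom3 1 q p)) \<union> line_at_infinity \<union>
    (\<Union>\<rho>\<in>cube_roots. exceptional_curve (centre1 \<rho>) \<union> exceptional_curve (centre2 z \<rho>) \<union>
      exceptional_curve (centre3 \<alpha> \<beta> z \<rho>))"
proof -
  let ?T = "blow_up_tower \<alpha> \<beta> z"
  have U: "chart_point (?T 1 CP2) U = U_point" "chart_point (?T omega (?T 1 CP2)) U = U_point"
    by (simp_all add: tower_other_chart tower_charts_def chart_point_CP2)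
  show ?thesis
    unfolding compact_space_def
    using points_CP2 points_tower[of CP2 \<alpha> \<beta> z 1]
      points_tower[of "?T 1 CP2" \<alpha> \<beta> z omega]
      points_tower[of "?T omega (?T 1 CP2)" \<alpha> \<beta> z "cnj omega"]
    by (simp only: U chart_point_CP2) blast
qed

text \<open>The curves over the second and the third centre meet in this point: in the chart
  \<open>Utilde1 \<rho>\<close> the former is the first axis \<open>{(0, y)}\<close>, and the point is the origin.\<close>

lemma corner_in_proper_transform:
  assumes "\<rho> \<in> cube_roots"
  shows "Near (centre3 \<alpha> \<beta> z \<rho>) (hom2 0 1)
    \<in> proper_transform (compact_space \<alpha> \<beta> z) (exceptional_curve (centre2 z \<rho>))"
proof -
  let ?S = "compact_space \<alpha> \<beta> z"
  let ?c = "chart_point ?S (Utilde1 \<rho>)"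
  note T = compact_tower[OF assms, where \<alpha> = \<alpha> and \<beta> = \<beta> and z = z]
  have pts: "?c (0, y) \<in> points ?S" for y
    using T(1)[of y] unfolding points_def by blast
  have P: "Near (centre3 \<alpha> \<beta> z \<rho>) (hom2 0 1) = ?c (0, 0)"
    by (simp add: T)
  have "\<exists>Q. Q \<in> exceptional_curve (centre2 z \<rho>) \<inter> points ?S \<and> Q \<in> V"
    if V: "?c (0, 0) \<in> V \<and> openin (surface_topology ?S) V" for V
  proof -
    have "openin (top_of_set (chart_dom ?S (Utilde1 \<rho>))) {w \<in> chart_dom ?S (Utilde1 \<rho>). ?c w \<in> V}"
      using V by (simp add: openin_surface_topology)
    then obtain B where B: "open B"
        "{w \<in> chart_dom ?S (Utilde1 \<rho>). ?c w \<in> V} = chart_dom ?S (Utilde1 \<rho>) \<inter> B"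
      by (auto simp: openin_open)
    have "(0, 0) \<in> B"
      using B(2) V T(1)[of 0] by blast
    then obtain e where e: "e > 0" "ball (0, 0) e \<subseteq> B"
      using B(1) openE by blast
    \<comment> \<open>A nonzero point of the axis inside the ball: being nonzero puts it on the
      second exceptional curve itself.\<close>
    define y :: complex where "y = of_real (e / 2)"
    have y: "y \<noteq> 0" "(0, y) \<in> B"
      using e by (auto simp: y_def dist_prod_def intro!: subsetD[OF e(2)])
    have "?c (0, y) \<in> V"
      using y(2) B(2) T(1)[of y] by blast
    moreover have "?c (0, y) \<in> exceptional_curve (centre2 z \<rho>)"
      using y(1) unfolding T exceptional_curve_def by force
    ultimately show ?thesis
      using pts by blast
  qed
  then show ?thesis
    unfolding proper_transform_def in_closure_of topspace_surface_topology P
    by (intro conjI pts allI impI)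
qed

text \<open>By elimination from \<open>points_compact_space\<close>. A proper transform contains
  whatever is left of its curve, so besides affine points only the third exceptional curves remain,
  and these lose their corner because removed curves are closed up.\<close>

lemma points_initial_space:
  assumes "P \<in> points (initial_space \<alpha> \<beta> z)"
  shows "(\<exists>q p. P = Proj (hom3 1 q p)) \<or>
    (\<exists>\<rho>\<in>cube_roots. \<exists>y. P = Near (centre3 \<alpha> \<beta> z \<rho>) (hom2 1 y))"
proof -
  let ?S = "compact_space \<alpha> \<beta> z"
  have P: "P \<in> points ?S" "P \<notin> removed_curves \<alpha> \<beta> z"
    using assms by (auto simp: points_def initial_space_def remove_def)
  have R: "P \<notin> proper_transform ?S line_at_infinity"
    "P \<notin> proper_transform ?S (exceptional_curve (centre1 \<rho>))"
    "P \<notin> proper_transform ?S (exceptional_curve (centre2 z \<rho>))" if "\<rho> \<in> cube_roots" for \<rho>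
    using P(2) that unfolding removed_curves_def Un_iff UN_iff by blast+
  have N: "P \<notin> C" if "P \<notin> proper_transform ?S C" for C
    using that P(1) proper_transform_superset[of C ?S] by blast
  have C: "P \<noteq> Near (centre3 \<alpha> \<beta> z \<rho>) (hom2 0 1)" if "\<rho> \<in> cube_roots" for \<rho>
    using R(3)[OF that] corner_in_proper_transform[OF that] by metis
  have "P \<in> range (\<lambda>(q, p). Proj (hom3 1 q p)) \<union> line_at_infinity \<union>
    (\<Union>\<rho>\<in>cube_roots. exceptional_curve (centre1 \<rho>) \<union> exceptional_curve (centre2 z \<rho>) \<union>
      exceptional_curve (centre3 \<alpha> \<beta> z \<rho>))"
    using P(1) points_compact_space by (rule subsetD[rotated])
  then show ?thesis
  proof (elim UnE UN_E rangeE)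
    fix w assume "P = (\<lambda>(q, p). Proj (hom3 1 q p)) w"
    then show ?thesis
      by (cases w) auto
  next
    assume "P \<in> line_at_infinity"
    then show ?thesis
      using N[OF R(1)[OF insertI1]] by contradiction
  next
    fix \<rho> assume \<rho>: "\<rho> \<in> cube_roots" and "P \<in> exceptional_curve (centre1 \<rho>)"
    from N[OF R(2)[OF \<rho>]] this(2) show ?thesis
      by contradiction
  next
    fix \<rho> assume \<rho>: "\<rho> \<in> cube_roots" and "P \<in> exceptional_curve (centre2 z \<rho>)"
    from N[OF R(3)[OF \<rho>]] this(2) show ?thesis
      by contradiction
  next
    fix \<rho> assume \<rho>: "\<rho> \<in> cube_roots" and "P \<in> exceptional_curve (centre3 \<alpha> \<beta> z \<rho>)"
    then obtain a b where ab: "P = Near (centre3 \<alpha> \<beta> z \<rho>) (hom2 a b)" "(a, b) \<noteq> (0, 0)"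
      unfolding exceptional_curve_def by blast
    \<comment> \<open>The direction with \<open>a = 0\<close> is the corner, already
      excluded.\<close>
    with C[OF \<rho>] have "a \<noteq> 0"
      using hom2_normalize(2)[of b] by auto
    then have "P = Near (centre3 \<alpha> \<beta> z \<rho>) (hom2 1 (b / a))"
      using ab(1) hom2_normalize(1)[of a b] by metis
    with \<rho> show ?thesis
      by blast
  qed
qed

text \<open>\<open>remove\<close> discards coordinate pairs according to the point they name, so a
  surviving point keeps its coordinates in every chart.\<close>

lemma initial_space_chart:
  assumes "P \<in> points (initial_space \<alpha> \<beta> z)"
    and "w \<in> chart_dom (compact_space \<alpha> \<beta> z) n" "chart_point (compact_space \<alpha> \<beta> z) n w = P"
  shows "w \<in> chart_dom (initial_space \<alpha> \<beta> z) n \<and> chart_point (initial_space \<alpha> \<beta> z) n w = P"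
  using assms by (auto simp: points_def initial_space_def remove_def)


section \<open>The system in the charts\<close>

text \<open>Affine coordinates are determined by the point, so \<open>q\<close>, \<open>p\<close>
  agree with \<open>x\<close>, \<open>y\<close> near \<open>z\<close> and have the same derivatives
  there.\<close>

lemma rewritten_system_QP:
  "rewritten_system \<alpha> \<beta> QP UNIV
    (\<lambda>v. (snd (snd v))\<^sup>2 + fst v * fst (snd v) + \<alpha>)
    (\<lambda>v. - (fst (snd v))\<^sup>2 - fst v * snd (snd v) - \<beta>)"
  unfolding rewritten_system_def
proof (intro allI impI, goal_cases)
  case (1 q p x y z)
  have ev: "\<forall>\<^sub>F t in nhds z. q t = x t" "\<forall>\<^sub>F t in nhds z. p t = y t"
    by (rule eventually_mono[OF 1(2)]; simp add: compact_QP hom3_1_eq_iff)+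
  have "q z = x z" "p z = y z"
    using ev[THEN eventually_nhds_x_imp_x] .
  moreover have "(q has_field_derivative D) (at z) \<longleftrightarrow> (x has_field_derivative D) (at z)"
    "(p has_field_derivative D) (at z) \<longleftrightarrow> (y has_field_derivative D) (at z)" for D
    by (rule DERIV_cong_ev[OF refl ev(1) refl], rule DERIV_cong_ev[OF refl ev(2) refl])
  ultimately show ?case
    by (simp add: system_at_def)
qed

section \<open>The vector field in the last chart over a base point\<close>

context
  fixes \<alpha> \<beta> \<rho> :: complex
begin

text \<open>The third centre, with \<open>cnj \<rho>\<close> written as
  \<open>\<rho>\<^sup>2\<close> so that all formulas are polynomial in
  \<open>\<rho>\<close>.\<close>

definition x2_coeff :: complex where
  "x2_coeff = \<rho>\<^sup>2 * \<alpha> - \<rho> * \<beta> - 1"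

text \<open>The coordinate \<open>u2 = p / q\<close> in terms of the time \<open>z\<close> and the coordinates \<open>(x, y)\<close> of the chart
  \<open>Utilde2 \<rho>\<close>, where \<open>q = 1 / x\<close>.\<close>

definition slope :: "complex \<times> complex \<times> complex \<Rightarrow> complex" where
  "slope = (\<lambda>(z, x, y). - \<rho> + x * (\<rho>\<^sup>2 * z + x * (x2_coeff + x * y)))"

text \<open>Since \<open>x = 1 / q\<close>, this is \<open>- x\<^sup>2 * q'\<close> with
  \<open>p = slope / x\<close> substituted into the first equation.\<close>

definition rhs_x :: "complex \<times> complex \<times> complex \<Rightarrow> complex" where
  "rhs_x = (\<lambda>(z, x, y). - ((slope (z, x, y))\<^sup>2 + z * x + \<alpha> * x\<^sup>2))"

text \<open>With \<open>- rhs_x = \<rho>\<^sup>2 - z x + b2 x\<^sup>2 + \<dots> + b6 x\<^sup>6\<close>, this is what remains of \<open>y'\<close>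
  after the choice of the three centres has cancelled its poles of orders 1 to 4 at \<open>x = 0\<close>.\<close>

definition rhs_y :: "complex \<times> complex \<times> complex \<Rightarrow> complex" where
  "rhs_y = (\<lambda>(z, x, y). let
     c = x2_coeff; b2 = \<rho> * z\<^sup>2 - 2 * \<rho> * c + \<alpha>; b3 = 2 * \<rho>\<^sup>2 * z * c - 2 * \<rho> * y;
     b4 = c\<^sup>2 + 2 * \<rho>\<^sup>2 * z * y; b5 = 2 * c * y; b6 = y\<^sup>2 in
     - z * y + \<rho> * (b4 + b5 * x + b6 * x\<^sup>2)
     + c * (b2 + b3 * x + b4 * x\<^sup>2 + b5 * x ^ 3 + b6 * x ^ 4)
     + 2 * y * (- z + b2 * x + b3 * x\<^sup>2 + b4 * x ^ 3 + b5 * x ^ 4 + b6 * x ^ 5))"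

lemma multiplier_rhs: "multiplier rhs_x" "multiplier rhs_y"
  unfolding rhs_x_def rhs_y_def slope_def Let_def case_prod_unfold fst_conv snd_conv
  by (intro multiplier_intros)+

text \<open>The right side is what \<open>x ^ 4 * y'\<close> must be: differentiate \<open>p = -
  \<rho> / x + \<rho>\<^sup>2 * z + x2_coeff * x + x\<^sup>2 * y\<close>, insert the second equation
  and solve. Regularity is its divisibility by \<open>x ^ 4\<close>.\<close>

lemma rhs_y_identity:
  assumes "\<rho> ^ 3 = 1"
  shows "x ^ 4 * rhs_y (z, x, y) = - 1 - z * x * slope (z, x, y) - \<beta> * x\<^sup>2 - \<rho>\<^sup>2 * x\<^sup>2
    - (\<rho> + x2_coeff * x\<^sup>2 + 2 * y * x ^ 3) * rhs_x (z, x, y)"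
proof -
  define c where "c = x2_coeff"
  define b2 where "b2 = \<rho> * z\<^sup>2 - 2 * \<rho> * c + \<alpha>"
  define b3 where "b3 = 2 * \<rho>\<^sup>2 * z * c - 2 * \<rho> * y"
  define b4 where "b4 = c\<^sup>2 + 2 * \<rho>\<^sup>2 * z * y"
  define b5 where "b5 = 2 * c * y"
  define b6 where "b6 = y\<^sup>2"
  \<comment> \<open>The resulting formula for \<open>\<beta>\<close> says exactly that the
    coefficient of \<open>x\<^sup>2\<close> on the right side vanishes.\<close>
  have "\<rho>\<^sup>2 * c = \<rho> * \<rho> ^ 3 * \<alpha> - \<rho> ^ 3 * \<beta> - \<rho>\<^sup>2"
    unfolding c_def x2_coeff_def by algebra
  then have \<beta>: "\<beta> = \<rho> * \<alpha> - \<rho>\<^sup>2 - \<rho>\<^sup>2 * c"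
    by (simp add: assms)
  have A: "slope (z, x, y) = - \<rho> + x * (\<rho>\<^sup>2 * z + x * (c + x * y))"
    by (simp add: slope_def c_def)
  \<comment> \<open>As \<open>algebra\<close> is not given \<open>\<rho> ^ 3 = 1\<close>, the
    multiple of \<open>\<rho> ^ 3 - 1\<close> is written out and dropped afterwards; the same device
    recurs below.\<close>
  have "rhs_x (z, x, y) =
      - (\<rho>\<^sup>2 - z * x + b2 * x\<^sup>2 + b3 * x ^ 3 + b4 * x ^ 4 + b5 * x ^ 5 + b6 * x ^ 6)
      - (\<rho> ^ 3 - 1) * (- 2 * z * x + \<rho> * z\<^sup>2 * x\<^sup>2)"
    unfolding rhs_x_def A b2_def b3_def b4_def b5_def b6_def prod.case by algebra
  then have F: "rhs_x (z, x, y) =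
      - (\<rho>\<^sup>2 - z * x + b2 * x\<^sup>2 + b3 * x ^ 3 + b4 * x ^ 4 + b5 * x ^ 5 + b6 * x ^ 6)"
    by (simp add: assms)
  have "x ^ 4 * rhs_y (z, x, y) = x ^ 4 * (- z * y + \<rho> * (b4 + b5 * x + b6 * x\<^sup>2)
     + c * (b2 + b3 * x + b4 * x\<^sup>2 + b5 * x ^ 3 + b6 * x ^ 4)
     + 2 * y * (- z + b2 * x + b3 * x\<^sup>2 + b4 * x ^ 3 + b5 * x ^ 4 + b6 * x ^ 5))"
    by (simp add: rhs_y_def Let_def b2_def b3_def b4_def b5_def b6_def flip: c_def)
  also have "\<dots> = - 1 - z * x * slope (z, x, y) - \<beta> * x\<^sup>2 - \<rho>\<^sup>2 * x\<^sup>2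
      - (\<rho> + c * x\<^sup>2 + 2 * y * x ^ 3) * rhs_x (z, x, y) - (\<rho> ^ 3 - 1) * (1 + 2 * c * z * x ^ 3)"
    unfolding A F b2_def b3_def by (subst \<beta>) algebra
  finally show ?thesis
    by (simp add: assms c_def)
qed

text \<open>The coordinate change is explicit in both directions and holds near \<open>z\<close>, so
  differentiability as well as the equations pass from either pair to the other.\<close>

lemma system_at_iff:
  assumes "\<rho> ^ 3 = 1"
    and ev: "\<forall>\<^sub>F t in nhds z. x t \<noteq> 0 \<and> q t = 1 / x t \<and> p t = slope (t, x t, y t) / x t"
  shows "system_at \<alpha> \<beta> q p z \<longleftrightarrow>
    (x has_field_derivative rhs_x (z, x z, y z)) (at z) \<and>
    (y has_field_derivative rhs_y (z, x z, y z)) (at z)"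
proof -
  define A where "A = slope (z, x z, y z)"
  define F where "F = rhs_x (z, x z, y z)"
  define G where "G = rhs_y (z, x z, y z)"
  define c where "c = x2_coeff"
  note defs = A_def[symmetric] F_def[symmetric] G_def[symmetric] c_def[symmetric]
  have z: "x z \<noteq> 0" "q z = 1 / x z" "p z = A / x z"
    using eventually_nhds_x_imp_x[OF ev] by (auto simp: A_def)
  have slope: "slope (t, x t, y t) = - \<rho> + x t * (\<rho>\<^sup>2 * t + x t * (c + x t * y t))" for t
    by (simp add: slope_def c_def)
  have G: "x z ^ 4 * G = - 1 - z * x z * A - \<beta> * (x z)\<^sup>2 - \<rho>\<^sup>2 * (x z)\<^sup>2
      - (\<rho> + c * (x z)\<^sup>2 + 2 * y z * x z ^ 3) * F"
    using rhs_y_identity[OF assms(1), of "x z" z "y z"] unfolding defs .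
  have F: "F = - (A\<^sup>2 + z * x z + \<alpha> * (x z)\<^sup>2)"
    by (simp add: F_def rhs_x_def A_def)
  have q': "(p z)\<^sup>2 + z * q z + \<alpha> = - F / (x z)\<^sup>2"
    using z(1) unfolding z(2,3) F by (simp add: field_simps power2_eq_square)
  \<comment> \<open>The right side is the derivative of \<open>p\<close> computed from
    \<open>x' = F\<close> and \<open>y' = G\<close>.\<close>
  have p': "- (q z)\<^sup>2 - z * p z - \<beta> =
      \<rho> * F / (x z)\<^sup>2 + \<rho>\<^sup>2 + c * F + 2 * x z * y z * F + (x z)\<^sup>2 * G"
  proof -
    have "(x z)\<^sup>2 * (- (q z)\<^sup>2 - z * p z - \<beta>) = - 1 - z * x z * A - \<beta> * (x z)\<^sup>2"
      using z(1) unfolding z(2,3) by (simp add: field_simps power2_eq_square)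
    also have "\<dots> = x z ^ 4 * G + \<rho>\<^sup>2 * (x z)\<^sup>2 + (\<rho> + c * (x z)\<^sup>2 + 2 * y z * x z ^ 3) * F"
      unfolding G by simp
    also have "\<dots> = (x z)\<^sup>2 *
        (\<rho> * F / (x z)\<^sup>2 + \<rho>\<^sup>2 + c * F + 2 * x z * y z * F + (x z)\<^sup>2 * G)"
      using z(1) by (simp add: field_simps power2_eq_square power3_eq_cube power4_eq_xxxx)
    finally show ?thesis
      using z(1) by simp
  qed
  have cong: "(f has_field_derivative D) (at z)"
    if "(g has_field_derivative D) (at z)" "\<forall>\<^sub>F t in nhds z. f t = g t" for f g and D :: complex
    using DERIV_cong_ev[OF refl that(2) refl] that(1) by blast
  show ?thesis
  proof
    assume "system_at \<alpha> \<beta> q p z"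
    then have q: "(q has_field_derivative - F / (x z)\<^sup>2) (at z)"
      and p: "(p has_field_derivative
        \<rho> * F / (x z)\<^sup>2 + \<rho>\<^sup>2 + c * F + 2 * x z * y z * F + (x z)\<^sup>2 * G) (at z)"
      unfolding system_at_def q' p' by blast+
    have q0: "q z \<noteq> 0"
      using z by simp
    have "((\<lambda>t. 1 / q t) has_field_derivative F) (at z)"
      by (rule derivative_eq_intros q q0 refl)+
        (use z(1) in \<open>simp add: z(2) field_simps power2_eq_square\<close>)
    moreover have "\<forall>\<^sub>F t in nhds z. x t = 1 / q t"
      by (rule eventually_mono[OF ev]) simp
    ultimately have x: "(x has_field_derivative F) (at z)"
      by (rule cong)
    \<comment> \<open>The formula for \<open>p\<close> solved for \<open>y\<close>, with
      \<open>1 / x\<^sup>2\<close> replaced by \<open>q\<^sup>2\<close>.\<close>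
    have "((\<lambda>t. (p t + \<rho> * q t - \<rho>\<^sup>2 * t - c * x t) * (q t)\<^sup>2) has_field_derivative G) (at z)"
      by (rule derivative_eq_intros p q x refl)+
        (use z(1) in \<open>simp add: z(2,3) A_def slope field_simps power2_eq_square\<close>)
    moreover have "\<forall>\<^sub>F t in nhds z. y t = (p t + \<rho> * q t - \<rho>\<^sup>2 * t - c * x t) * (q t)\<^sup>2"
      by (rule eventually_mono[OF ev]) (simp add: slope field_simps power2_eq_square)
    ultimately have "(y has_field_derivative G) (at z)"
      by (rule cong)
    with x show "(x has_field_derivative rhs_x (z, x z, y z)) (at z) \<and>
        (y has_field_derivative rhs_y (z, x z, y z)) (at z)"
      unfolding defs by blast
  next
    assume "(x has_field_derivative rhs_x (z, x z, y z)) (at z) \<and>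
        (y has_field_derivative rhs_y (z, x z, y z)) (at z)"
    then have x: "(x has_field_derivative F) (at z)" and y: "(y has_field_derivative G) (at z)"
      unfolding defs by blast+
    have "((\<lambda>t. 1 / x t) has_field_derivative - F / (x z)\<^sup>2) (at z)"
      by (rule derivative_eq_intros x z(1) refl)+ (simp add: power2_eq_square)
    moreover have "\<forall>\<^sub>F t in nhds z. q t = 1 / x t"
      by (rule eventually_mono[OF ev]) simp
    ultimately have q: "(q has_field_derivative - F / (x z)\<^sup>2) (at z)"
      by (rule cong)
    have "((\<lambda>t. - \<rho> / x t + \<rho>\<^sup>2 * t + c * x t + (x t)\<^sup>2 * y t) has_field_derivative
        \<rho> * F / (x z)\<^sup>2 + \<rho>\<^sup>2 + c * F + 2 * x z * y z * F + (x z)\<^sup>2 * G) (at z)"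
      by (rule derivative_eq_intros x y z(1) refl)+
        (use z(1) in \<open>simp add: field_simps power2_eq_square\<close>)
    moreover have "\<forall>\<^sub>F t in nhds z. p t = - \<rho> / x t + \<rho>\<^sup>2 * t + c * x t + (x t)\<^sup>2 * y t"
      by (rule eventually_mono[OF ev]) (simp add: slope field_simps power2_eq_square)
    ultimately have "(p has_field_derivative
        \<rho> * F / (x z)\<^sup>2 + \<rho>\<^sup>2 + c * F + 2 * x z * y z * F + (x z)\<^sup>2 * G) (at z)"
      by (rule cong)
    with q show "system_at \<alpha> \<beta> q p z"
      unfolding system_at_def q' p' by blast
  qed
qed

text \<open>At each time \<open>t\<close> the point is affine, whereas \<open>x t = 0\<close> would
  make it infinitely near; so \<open>x t\<close> is nonzero and comparing homogeneous coordinates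
  gives \<open>q t\<close> and \<open>p t\<close>.\<close>

lemma rewritten_system_Utilde2:
  assumes "\<rho> \<in> cube_roots"
  shows "rewritten_system \<alpha> \<beta> (Utilde2 \<rho>) UNIV rhs_x rhs_y"
  unfolding rewritten_system_def
proof (intro allI impI, goal_cases)
  case (1 q p x y z)
  note \<rho> = cube_roots[OF assms]
  have "\<forall>\<^sub>F t in nhds z. x t \<noteq> 0 \<and> q t = 1 / x t \<and> p t = slope (t, x t, y t) / x t"
  proof (rule eventually_mono[OF 1(2)])
    fix t
    assume "(x t, y t) \<in> chart_dom (compact_space \<alpha> \<beta> t) (Utilde2 \<rho>) \<and>
      chart_point (compact_space \<alpha> \<beta> t) (Utilde2 \<rho>) (x t, y t) =
      chart_point (compact_space \<alpha> \<beta> t) QP (q t, p t)"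
    then have "Proj (hom3 1 (q t) (p t)) = (if x t = 0 then Near (centre3 \<alpha> \<beta> t \<rho>) (hom2 1 (y t))
        else U_point (x t, slope (t, x t, y t)))"
      unfolding compact_QP compact_tower(4)[OF assms] \<rho>(2) slope_def x2_coeff_def prod.case
      by (rule sym[OF conjunct2])
    then show "x t \<noteq> 0 \<and> q t = 1 / x t \<and> p t = slope (t, x t, y t) / x t"
      by (auto simp: U_point_def hom3_1_eq_iff split: if_splits)
  qed
  then show ?case
    by (rule system_at_iff[OF \<rho>(1)])
qed

end

theorem mainTheorem2:
  fixes \<alpha> \<beta> :: complex
  shows "\<forall>z\<^sub>0. \<forall>P \<in> points (initial_space \<alpha> \<beta> z\<^sub>0).
    \<exists>n x\<^sub>0 y\<^sub>0. (x\<^sub>0, y\<^sub>0) \<in> chart_dom (initial_space \<alpha> \<beta> z\<^sub>0) n \<and>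
      chart_point (initial_space \<alpha> \<beta> z\<^sub>0) n (x\<^sub>0, y\<^sub>0) = P \<and>
      (\<exists>W F G. open W \<and> (z\<^sub>0, x\<^sub>0, y\<^sub>0) \<in> W \<and>
        rewritten_system \<alpha> \<beta> n W F G \<and> analytic3_on F W \<and> analytic3_on G W)"
proof (intro allI ballI)
  fix z P assume P: "P \<in> points (initial_space \<alpha> \<beta> z)"
  show "\<exists>n x\<^sub>0 y\<^sub>0. (x\<^sub>0, y\<^sub>0) \<in> chart_dom (initial_space \<alpha> \<beta> z) n \<and>
      chart_point (initial_space \<alpha> \<beta> z) n (x\<^sub>0, y\<^sub>0) = P \<and>
      (\<exists>W F G. open W \<and> (z, x\<^sub>0, y\<^sub>0) \<in> W \<and>
        rewritten_system \<alpha> \<beta> n W F G \<and> analytic3_on F W \<and> analytic3_on G W)" (is ?regular)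
  proof -
    \<comment> \<open>The right-hand sides are polynomials, so the neighbourhood can be the whole
      space.\<close>
    have regular: ?regular if "(x, y) \<in> chart_dom (compact_space \<alpha> \<beta> z) n"
      "chart_point (compact_space \<alpha> \<beta> z) n (x, y) = P"
      "rewritten_system \<alpha> \<beta> n UNIV F G" "multiplier F" "multiplier G" for n x y F G
      using initial_space_chart[OF P that(1,2)] that(3)
        multiplier_analytic3_on[OF that(4)] multiplier_analytic3_on[OF that(5)]
      by (intro exI[of _ n] exI[of _ x] exI[of _ y] conjI exI[of _ UNIV] exI[of _ F] exI[of _ G]) auto
    from points_initial_space[OF P] show ?regular
    proof (elim disjE exE bexE)
      fix q p assume "P = Proj (hom3 1 q p)"
      then show ?regular
        by (intro regular[OF _ _ rewritten_system_QP, of q p] multiplier_intros) (simp_all add: compact_QP)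
    next
      fix \<rho> y assume "\<rho> \<in> cube_roots" "P = Near (centre3 \<alpha> \<beta> z \<rho>) (hom2 1 y)"
      then show ?regular
        by (intro regular[OF _ _ rewritten_system_Utilde2, of 0 y \<rho>] multiplier_rhs compact_tower)
          (simp_all only: compact_tower if_True refl)
    qed
  qed
qed

end
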